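(* Let $d\geq 2$ and let $\mathbb{S}^{2d-1}=\{(z_1,\ldots,z_d)\in\mathbb{C}^d : \sum_{j=1}^d|z_j|^2=1\}$ be the sphere with the standard contact structure $\xi_{st}=\ker\alpha_{st}$, $\alpha_{st}=\frac{i}{4}\sum_{j=1}^d(z_j\,d\bar z_j-\bar z_j\,dz_j)$, and the standard action of $\mathbb{T}^d$ by coordinatewise rotation. Then every pre-Lagrangian toric fiber of $(\mathbb{S}^{2d-1},\xi_{st})$, i.e. every submanifold $$L_{c_1,\ldots,c_d}=\{(z_1,\ldots,z_d)\in\mathbb{S}^{2d-1} : |z_j|=c_j,\ j=1,\ldots,d\}$$ with $c_j\in(0,1)$ and $\sum_{j=1}^d c_j^2=1$, is displaceable.
   Context: A contact isotopy of a contact manifold $(V,\xi)$ is a smooth family $\{\varphi_t\}_{t\in[0,1]}$ of diffeomorphisms of $V$ preserving $\xi$. A subset $L\subset V$ is called displaceable if there is a contact isotopy $\{\varphi_t\}_{t\in[0,1]}$ of $(V,\xi)$ with $\varphi_0=\mathrm{id}$ and $\varphi_1(L)\cap L=\emptyset$; otherwise it is non-displaceable. *)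

theory Defs
  imports "HOL-Analysis.Analysis"
begin

text \<open>Smooth (i.e. of class \<open>C\<^sup>\<infinity>\<close>) maps on an open subset of a Euclidean space: all iterated
  directional derivatives exist, are Frechet differentiable and hence continuous.\<close>

primrec Ck_on_open :: "nat \<Rightarrow> 'a::euclidean_space set \<Rightarrow> ('a \<Rightarrow> 'b::euclidean_space) \<Rightarrow> bool" where
  "Ck_on_open 0 U f \<longleftrightarrow> continuous_on U f"
| "Ck_on_open (Suc k) U f \<longleftrightarrow>
     (\<forall>x\<in>U. f differentiable (at x)) \<and>
     (\<forall>v. Ck_on_open k U (\<lambda>x. frechet_derivative f (at x) v))"

definition smooth_on_open :: "'a::euclidean_space set \<Rightarrow> ('a \<Rightarrow> 'b::euclidean_space) \<Rightarrow> bool" where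
  "smooth_on_open U f \<longleftrightarrow> open U \<and> (\<forall>k. Ck_on_open k U f)"

text \<open>Manifolds (possibly with boundary, such as \<open>[0,1] \<times> M\<close>) are treated as subsets of a Euclidean
  space.  A map on such a subset is smooth if near each point it is the restriction of a smooth map
  of the ambient space; for embedded submanifolds this is smoothness in charts.\<close>

definition smooth_map_on :: "'a::euclidean_space set \<Rightarrow> ('a \<Rightarrow> 'b::euclidean_space) \<Rightarrow> bool" where
  "smooth_map_on M f \<longleftrightarrow>
     (\<forall>p\<in>M. \<exists>U F. p \<in> U \<and> smooth_on_open U F \<and> (\<forall>x\<in>U \<inter> M. F x = f x))"

definition diffeomorphism_of :: "'a::euclidean_space set \<Rightarrow> ('a \<Rightarrow> 'a) \<Rightarrow> bool" where
  "diffeomorphism_of M f \<longleftrightarrow>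
     bij_betw f M M \<and> smooth_map_on M f \<and> smooth_map_on M (inv_into M f)"

definition smooth_curve_at :: "'a::euclidean_space set \<Rightarrow> 'a \<Rightarrow> (real \<Rightarrow> 'a) \<Rightarrow> bool" where
  "smooth_curve_at M p \<gamma> \<longleftrightarrow>
     \<gamma> 0 = p \<and> (\<exists>e>0. smooth_on_open {-e<..<e} \<gamma> \<and> \<gamma> ` {-e<..<e} \<subseteq> M)"

definition tangent_space :: "'a::euclidean_space set \<Rightarrow> 'a \<Rightarrow> 'a set" where
  "tangent_space M p =
     {v. \<exists>\<gamma>. smooth_curve_at M p \<gamma> \<and> (\<gamma> has_vector_derivative v) (at 0)}"

text \<open>The differential of \<open>f\<close> at \<open>p\<close>; meaningful only for \<open>f\<close> smooth on \<open>M\<close> and \<open>v\<close> tangent to \<open>M\<close>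
  at \<open>p\<close>, where the vector on the right-hand side exists and is unique (see
  \<open>differential_eq\<close> below).\<close>

definition differential ::
    "'a::euclidean_space set \<Rightarrow> ('a \<Rightarrow> 'b::euclidean_space) \<Rightarrow> 'a \<Rightarrow> 'a \<Rightarrow> 'b" where
  "differential M f p v =
     (THE w. \<forall>\<gamma>. smooth_curve_at M p \<gamma> \<and> (\<gamma> has_vector_derivative v) (at 0)
            \<longrightarrow> ((\<lambda>t. f (\<gamma> t)) has_vector_derivative w) (at 0))"

lemma differential_eq:
  assumes "v \<in> tangent_space M p"
    and F: "(F has_derivative F') (at p)" and U: "open U" "p \<in> U"
    and eq: "\<And>x. x \<in> U \<inter> M \<Longrightarrow> F x = f x"
  shows "differential M f p v = F' v"
proof -
  have *: "((\<lambda>t. f (\<gamma> t)) has_vector_derivative F' v) (at 0)"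
    if c: "smooth_curve_at M p \<gamma>" and d: "(\<gamma> has_vector_derivative v) (at 0)" for \<gamma>
  proof -
    from c obtain e where e: "e > 0" "\<gamma> ` {-e<..<e} \<subseteq> M" and p: "\<gamma> 0 = p"
      unfolding smooth_curve_at_def by auto
    have "isCont \<gamma> 0"
      using d by (rule has_vector_derivative_continuous)
    then have "(\<gamma> \<longlongrightarrow> p) (nhds 0)"
      using p by (simp add: isCont_def tendsto_nhds_iff)
    then have ev1: "eventually (\<lambda>t. \<gamma> t \<in> U) (nhds 0)"
      using U by (rule topological_tendstoD)
    have ev2: "eventually (\<lambda>t. t \<in> {-e<..<e}) (nhds 0)"
      using e by (intro eventually_nhds_in_open) auto
    have ev: "eventually (\<lambda>t. F (\<gamma> t) = f (\<gamma> t)) (nhds 0)"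
      using ev1 ev2
    proof eventually_elim
      case (elim t)
      then have "\<gamma> t \<in> U \<inter> M"
        using e(2) by blast
      then show ?case
        by (rule eq)
    qed
    have "(F \<circ> \<gamma> has_derivative F' \<circ> (\<lambda>h. h *\<^sub>R v)) (at 0)"
      using d F p unfolding has_vector_derivative_def by (intro diff_chain_at) auto
    moreover have "F' (h *\<^sub>R v) = h *\<^sub>R F' v" for h
      using has_derivative_linear[OF F] by (rule linear_scale)
    ultimately have D: "((\<lambda>t. F (\<gamma> t)) has_vector_derivative F' v) (at 0)"
      unfolding has_vector_derivative_def by (simp add: o_def)
    from ev obtain S where S: "open S" "0 \<in> S" "\<And>t. t \<in> S \<Longrightarrow> F (\<gamma> t) = f (\<gamma> t)"
      unfolding eventually_nhds by auto
    show ?thesis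
      by (rule has_vector_derivative_transform_within_open[OF D S])
  qed
  from assms(1) obtain \<gamma> where "smooth_curve_at M p \<gamma>" "(\<gamma> has_vector_derivative v) (at 0)"
    unfolding tangent_space_def by auto
  then have "w = F' v" if "\<forall>\<gamma>. smooth_curve_at M p \<gamma> \<and> (\<gamma> has_vector_derivative v) (at 0)
            \<longrightarrow> ((\<lambda>t. f (\<gamma> t)) has_vector_derivative w) (at 0)" for w
    using that *[of \<gamma>] vector_derivative_unique_at[of "\<lambda>t. f (\<gamma> t)" w 0 "F' v"] by simp
  with * show ?thesis
    unfolding differential_def by (intro the_equality) simp_all
qed

text \<open>A plane field on \<open>M\<close> is given by the family of its fibers \<open>\<xi> p\<close>.\<close>

definition preserves_field :: "'a::euclidean_space set \<Rightarrow> ('a \<Rightarrow> 'a set) \<Rightarrow> ('a \<Rightarrow> 'a) \<Rightarrow> bool" where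
  "preserves_field M \<xi> f \<longleftrightarrow> (\<forall>p\<in>M. differential M f p ` \<xi> p = \<xi> (f p))"

text \<open>Only the values \<open>\<phi> t x\<close> for \<open>t \<in> [0,1]\<close> and \<open>x \<in> M\<close> are relevant.\<close>

definition contact_isotopy ::
    "'a::euclidean_space set \<Rightarrow> ('a \<Rightarrow> 'a set) \<Rightarrow> (real \<Rightarrow> 'a \<Rightarrow> 'a) \<Rightarrow> bool" where
  "contact_isotopy M \<xi> \<phi> \<longleftrightarrow>
     smooth_map_on ({0..1} \<times> M) (\<lambda>(t, x). \<phi> t x) \<and>
     (\<forall>t\<in>{0..1}. diffeomorphism_of M (\<phi> t) \<and> preserves_field M \<xi> (\<phi> t))"

definition displaceable :: "'a::euclidean_space set \<Rightarrow> ('a \<Rightarrow> 'a set) \<Rightarrow> 'a set \<Rightarrow> bool" where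
  "displaceable M \<xi> L \<longleftrightarrow>
     (\<exists>\<phi>. contact_isotopy M \<xi> \<phi> \<and> (\<forall>x\<in>M. \<phi> 0 x = x) \<and> \<phi> 1 ` L \<inter> L = {})"

definition std_sphere :: "(complex ^ 'd) set" where
  "std_sphere = {z. (\<Sum>j\<in>UNIV. (cmod (z $ j))\<^sup>2) = 1}"

lemma std_sphere_eq_sphere: "(std_sphere :: (complex ^ 'd) set) = sphere 0 1"
  by (auto simp: std_sphere_def norm_vec_def L2_set_def)

text \<open>\<open>alpha_st z v\<close> is the value at \<open>z\<close> of the standard form on the vector \<open>v\<close>, where
  \<open>dz\<^sub>j v = v\<^sub>j\<close>; it is real-valued although the formula is complex.\<close>

definition alpha_st :: "complex ^ 'd \<Rightarrow> complex ^ 'd \<Rightarrow> complex" where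
  "alpha_st z v = \<i> / 4 * (\<Sum>j\<in>UNIV. z $ j * cnj (v $ j) - cnj (z $ j) * v $ j)"

lemma alpha_st_in_Reals: "alpha_st z v \<in> \<real>"
proof -
  have "z $ j * cnj (v $ j) - cnj (z $ j) * v $ j
          = 2 * \<i> * of_real (Im (z $ j * cnj (v $ j)))" for j
    by (simp add: complex_eq_iff)
  then show ?thesis
    by (simp add: alpha_st_def sum_distrib_left[symmetric] flip: of_real_sum)
qed

definition xi_st :: "complex ^ 'd \<Rightarrow> (complex ^ 'd) set" where
  "xi_st z = {v \<in> tangent_space std_sphere z. alpha_st z v = 0}"

definition toric_fiber :: "real ^ 'd \<Rightarrow> (complex ^ 'd) set" where
  "toric_fiber c = {z \<in> std_sphere. \<forall>j. cmod (z $ j) = c $ j}"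

end

theory Submission
  imports Defs
begin

text \<open>
  The contact planes of the sphere are its complex tangent spaces, so every biholomorphic
  automorphism of the unit ball restricts to a contactomorphism of the boundary sphere, and a path
  of automorphisms starting at the identity is a contact isotopy.  Unitary maps do not displace,
  for instance, the Clifford torus in \<open>S\<^sup>3\<close>, but hyperbolic translations do displace
  every fiber.

  Fix a coordinate \<open>k\<close>.  The translation of the ball along the \<open>k\<close>-th axis by the
  parameter \<open>u\<close> acts on the \<open>k\<close>-th coordinate as the Moebius map
  \<open>\<zeta> \<mapsto> ((1 + u\<^sup>2) \<zeta> + 2 u) / ((1 + u\<^sup>2) + 2 u \<zeta>)\<close>
  of the unit disc, which is the hyperbolic translation taking \<open>-u\<close> to \<open>u\<close>.  A point
  of the fiber has its \<open>k\<close>-th coordinate on the circle of radius \<open>c\<^sub>k < 1\<close>.  If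
  \<open>c\<^sub>k < u < 1\<close>, the translation is longer than the hyperbolic diameter of the disc
  bounded by this circle, so it moves the circle off itself: every \<open>k\<close>-th coordinate acquires
  a modulus larger than \<open>c\<^sub>k\<close> (\<open>ball_translation_pushes_off\<close>).  Letting the
  parameter grow from \<open>0\<close> to such a \<open>u\<close> gives the isotopy.

  In homogeneous coordinates a translation is a linear map that multiplies the hermitian form of
  signature \<open>(d, 1)\<close> by a positive constant (\<open>bt_hermitian\<close>).  This yields at once
  that it preserves the sphere and that it rescales the contact form
  (\<open>alpha_st_ball_translation\<close>); its inverse is the translation by \<open>-u\<close>.
\<close>

section \<open>Closure properties of smooth maps\<close>

lemma Ck_on_open_cong:
  assumes "open U" "\<And>x. x \<in> U \<Longrightarrow> f x = g x" "Ck_on_open k U f"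
  shows "Ck_on_open k U g"
  using assms(2,3)
proof (induction k arbitrary: f g)
  case 0
  then show ?case using continuous_on_cong by fastforce
next
  case (Suc k)
  have D: "(g has_derivative frechet_derivative f (at x)) (at x)" if "x \<in> U" for x
    using Suc.prems that \<open>open U\<close>
    by (auto intro: has_derivative_transform_within_open simp: frechet_derivative_works)
  have "Ck_on_open k U (\<lambda>x. frechet_derivative g (at x) v)" for v
  proof (rule Suc.IH)
    show "Ck_on_open k U (\<lambda>x. frechet_derivative f (at x) v)"
      using Suc.prems by simp
    show "frechet_derivative f (at x) v = frechet_derivative g (at x) v" if "x \<in> U" for x
      using frechet_derivative_at[OF D[OF that]] by simp
  qed
  then show ?case
    using D by (auto simp: differentiable_def)
qed

text \<open>The closure properties below rest on inductions on the order of differentiability, in which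
  this rule replaces the chosen derivative by the one that the calculus rules produce.\<close>

lemma Ck_on_open_SucI:
  assumes "open U" "\<And>x. x \<in> U \<Longrightarrow> (f has_derivative f' x) (at x)"
    and "\<And>v. Ck_on_open k U (\<lambda>x. f' x v)"
  shows "Ck_on_open (Suc k) U f"
proof -
  have "Ck_on_open k U (\<lambda>x. frechet_derivative f (at x) v)" for v
    by (rule Ck_on_open_cong[OF assms(1) _ assms(3)])
      (use frechet_derivative_at[OF assms(2)] in simp)
  then show ?thesis
    using assms(2) by (auto simp: differentiable_def)
qed

lemma Ck_on_open_Suc_derivative:
  assumes "Ck_on_open (Suc k) U f" "x \<in> U"
  shows "(f has_derivative frechet_derivative f (at x)) (at x)"
  using assms by (simp add: frechet_derivative_works)

lemma Ck_on_open_Suc_imp: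
  "Ck_on_open (Suc k) U f \<Longrightarrow> Ck_on_open k U f"
proof (induction k arbitrary: f)
  case 0
  then show ?case
    by (auto intro!: differentiable_imp_continuous_on simp: differentiable_on_def
        differentiable_at_withinI)
next
  case (Suc k)
  then show ?case by (metis Ck_on_open.simps(2))
qed

lemma Ck_on_open_const: "open U \<Longrightarrow> Ck_on_open k U (\<lambda>x. c)"
  by (induction k arbitrary: c)
    (auto intro!: Ck_on_open_SucI[where f' = "\<lambda>x v. 0"] simp del: Ck_on_open.simps(2))

lemma Ck_on_open_ident: "open U \<Longrightarrow> Ck_on_open k U (\<lambda>x. x)"
  by (cases k) (auto intro!: Ck_on_open_SucI[where f' = "\<lambda>x v. v"] Ck_on_open_const
      simp del: Ck_on_open.simps(2))

lemma Ck_on_open_bounded_linear: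
  assumes "bounded_linear L" "open U" "Ck_on_open k U f"
  shows "Ck_on_open k U (\<lambda>x. L (f x))"
  using assms(3)
proof (induction k arbitrary: f)
  case 0
  then show ?case
    by (auto intro: bounded_linear.continuous_on[OF assms(1)])
next
  case (Suc k)
  show ?case
    by (rule Ck_on_open_SucI[OF assms(2)
          bounded_linear.has_derivative[OF assms(1) Ck_on_open_Suc_derivative[OF Suc.prems]]])
      (use Suc in auto)
qed

lemma Ck_on_open_add:
  assumes "open U" "Ck_on_open k U f" "Ck_on_open k U g"
  shows "Ck_on_open k U (\<lambda>x. f x + g x)"
  using assms(2,3)
proof (induction k arbitrary: f g)
  case 0
  then show ?case by (auto intro: continuous_on_add)
next
  case (Suc k)
  show ?case
    by (rule Ck_on_open_SucI[OF assms(1)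
          has_derivative_add[OF Suc.prems[THEN Ck_on_open_Suc_derivative]]])
      (use Suc in auto)
qed

lemma Ck_on_open_sum:
  assumes "open U" "\<And>i. i \<in> I \<Longrightarrow> Ck_on_open k U (f i)"
  shows "Ck_on_open k U (\<lambda>x. \<Sum>i\<in>I. f i x)"
  using assms(2)
  by (induction I rule: infinite_finite_induct)
    (auto intro!: Ck_on_open_const Ck_on_open_add assms(1))

lemma Ck_on_open_bilinear:
  assumes "bounded_bilinear B" "open U" "Ck_on_open k U f" "Ck_on_open k U g"
  shows "Ck_on_open k U (\<lambda>x. B (f x) (g x))"
  using assms(3,4)
proof (induction k arbitrary: f g)
  case 0
  then show ?case by (auto intro: bounded_bilinear.continuous_on[OF assms(1)])
next
  case (Suc k)
  show ?case
    by (rule Ck_on_open_SucI[OF assms(2)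
          bounded_bilinear.FDERIV[OF assms(1) Suc.prems[THEN Ck_on_open_Suc_derivative]]])
      (use Suc.prems Suc.prems[THEN Ck_on_open_Suc_imp] in
        \<open>auto intro!: Ck_on_open_add assms(2) Suc.IH\<close>)
qed

lemmas Ck_on_open_mult = Ck_on_open_bilinear[OF bounded_bilinear_mult]

lemma Ck_on_open_inverse:
  fixes f :: "'a::euclidean_space \<Rightarrow> 'b::{euclidean_space, real_normed_field}"
  assumes "open U" "\<And>x. x \<in> U \<Longrightarrow> f x \<noteq> 0" "Ck_on_open k U f"
  shows "Ck_on_open k U (\<lambda>x. inverse (f x))"
  using assms(3)
proof (induction k)
  case 0
  then show ?case using assms(2) by (auto intro: continuous_on_inverse)
next
  case (Suc k)
  have inv: "Ck_on_open k U (\<lambda>x. inverse (f x))"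
    using Suc Ck_on_open_Suc_imp by blast
  show ?case
  proof (rule Ck_on_open_SucI[OF assms(1)
        Deriv.has_derivative_inverse[OF assms(2) Ck_on_open_Suc_derivative[OF Suc.prems]]])
    show "Ck_on_open k U (\<lambda>x. - (inverse (f x) * frechet_derivative f (at x) v * inverse (f x)))"
      for v
      using Suc.prems inv
      by (intro Ck_on_open_bounded_linear[OF bounded_linear_minus[OF bounded_linear_ident]]
          Ck_on_open_mult assms(1)) auto
  qed
qed

lemma bounded_linear_axis: "bounded_linear (axis j :: 'a::real_normed_vector \<Rightarrow> 'a ^ 'n)"
proof (rule bounded_linear_intro[where K = 1])
  show "norm (axis j x :: 'a ^ 'n) \<le> norm x * 1" for x
    by (simp add: norm_vec_def axis_def L2_set_def if_distrib[of norm] if_distrib[of "\<lambda>x. x\<^sup>2"]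
        cong: if_cong)
qed (auto simp: axis_def vec_eq_iff)

lemma sum_axis_component: "(\<Sum>j\<in>UNIV. axis j (x $ j)) = (x :: 'a::real_normed_vector ^ 'n)"
  by (simp add: vec_eq_iff axis_def if_distrib cong: if_cong)

text \<open>Writing a vector as the sum of its components along the axes reduces differentiability and
  smoothness to the components.\<close>

lemma has_derivative_vec:
  fixes f :: "'a::real_normed_vector \<Rightarrow> 'b::real_normed_vector ^ 'n"
  assumes "\<And>j. ((\<lambda>x. f x $ j) has_derivative (\<lambda>v. f' v $ j)) F"
  shows "(f has_derivative f') F"
proof -
  have "((\<lambda>x. \<Sum>j\<in>UNIV. axis j (f x $ j)) has_derivative (\<lambda>v. \<Sum>j\<in>UNIV. axis j (f' v $ j))) F"
    by (intro has_derivative_sum bounded_linear.has_derivative[OF bounded_linear_axis] assms)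
  then show ?thesis
    by (simp add: sum_axis_component)
qed

lemma Ck_on_open_vec:
  fixes f :: "'a::euclidean_space \<Rightarrow> 'b::euclidean_space ^ 'n"
  assumes "open U" "\<And>j. Ck_on_open k U (\<lambda>x. f x $ j)"
  shows "Ck_on_open k U f"
proof -
  have "Ck_on_open k U (\<lambda>x. \<Sum>j\<in>UNIV. axis j (f x $ j))"
    by (intro Ck_on_open_sum Ck_on_open_bounded_linear[OF bounded_linear_axis] assms)
  then show ?thesis
    by (simp add: sum_axis_component)
qed

section \<open>Translations of the ball\<close>

text \<open>The translation is kept as a quotient of two maps that are affine in \<open>z\<close>.  Together
  they are the image of the homogeneous coordinates \<open>(z, 1)\<close> under a linear map.  The
  parameter \<open>u\<close> is the image of the origin under the translation by half the length.  With
  this choice the coefficients are polynomials in \<open>u\<close>, without the square root that appears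
  when the image of the origin under the translation itself is the parameter.\<close>

definition bt_num :: "'d \<Rightarrow> real \<Rightarrow> complex ^ 'd \<Rightarrow> complex ^ 'd" where
  "bt_num k u z = (\<chi> j. if j = k then of_real (1 + u\<^sup>2) * z $ k + of_real (2 * u)
                         else of_real (1 - u\<^sup>2) * z $ j)"

definition bt_den :: "'d \<Rightarrow> real \<Rightarrow> complex ^ 'd \<Rightarrow> complex" where
  "bt_den k u z = of_real (1 + u\<^sup>2) + of_real (2 * u) * z $ k"

definition ball_translation :: "'d \<Rightarrow> real \<Rightarrow> complex ^ 'd \<Rightarrow> complex ^ 'd" where
  "ball_translation k u z = (\<chi> j. bt_num k u z $ j / bt_den k u z)"

text \<open>The quotient rule.  Since numerator and denominator are affine, their derivatives are
  written as increments, so that the invariance of the hermitian form can be applied to them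
  directly.\<close>

definition bt_deriv :: "'d \<Rightarrow> real \<Rightarrow> complex ^ 'd \<Rightarrow> complex ^ 'd \<Rightarrow> complex ^ 'd" where
  "bt_deriv k u z v = (\<chi> j.
     ((bt_num k u (z + v) $ j - bt_num k u z $ j) * bt_den k u z
       - bt_num k u z $ j * (bt_den k u (z + v) - bt_den k u z)) / (bt_den k u z)\<^sup>2)"

text \<open>The parameter and the point both depend on \<open>x\<close>; the cases needed are a single
  translation, a translation of a curve, and the whole isotopy as a map of time and point.\<close>

lemma Ck_on_open_ball_translation:
  fixes z :: "'a::euclidean_space \<Rightarrow> complex ^ 'd" and u :: "'a \<Rightarrow> real"
  assumes U: "open U" and u: "Ck_on_open n U u" and z: "Ck_on_open n U z"
    and "\<And>x. x \<in> U \<Longrightarrow> bt_den k (u x) (z x) \<noteq> 0"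
  shows "Ck_on_open n U (\<lambda>x. ball_translation k (u x) (z x))"
proof -
  have c: "Ck_on_open n U (\<lambda>x. complex_of_real (u x))"
    by (rule Ck_on_open_bounded_linear[OF bounded_linear_of_real U u])
  have zj: "Ck_on_open n U (\<lambda>x. z x $ j)" for j
    by (rule Ck_on_open_bounded_linear[OF bounded_linear_vec_nth U z])
  note intros = Ck_on_open_add Ck_on_open_mult Ck_on_open_const c zj U
  have s: "Ck_on_open n U (\<lambda>x. 1 + complex_of_real (u x) * complex_of_real (u x))"
    "Ck_on_open n U (\<lambda>x. 1 + (-1) * (complex_of_real (u x) * complex_of_real (u x)))"
    "Ck_on_open n U (\<lambda>x. 2 * complex_of_real (u x))"
    by (intro intros)+
  have num: "Ck_on_open n U (\<lambda>x. bt_num k (u x) (z x) $ j)" for j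
    using Ck_on_open_add[OF U Ck_on_open_mult[OF U s(1) zj[of k]] s(3)]
      Ck_on_open_mult[OF U s(2) zj[of j]]
    by (cases "j = k") (simp_all add: bt_num_def power2_eq_square)
  have den: "Ck_on_open n U (\<lambda>x. bt_den k (u x) (z x))"
    using Ck_on_open_add[OF U s(1) Ck_on_open_mult[OF U s(3) zj[of k]]]
    by (simp add: bt_den_def power2_eq_square)
  show ?thesis
    by (rule Ck_on_open_vec[OF U])
      (use Ck_on_open_mult[OF U num Ck_on_open_inverse[OF U assms(4) den]] in
        \<open>simp add: ball_translation_def divide_inverse\<close>)
qed

lemma ball_translation_has_derivative:
  assumes "bt_den k u z \<noteq> 0"
  shows "(ball_translation k u has_derivative bt_deriv k u z) (at z)"
proof (rule has_derivative_vec)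
  fix j
  have lin: "((\<lambda>z. z $ i) has_derivative (\<lambda>v. v $ i)) (at z)" for i
    by (rule bounded_linear_imp_has_derivative[OF bounded_linear_vec_nth])
  have num: "((\<lambda>z. bt_num k u z $ j) has_derivative
      (\<lambda>v. bt_num k u (z + v) $ j - bt_num k u z $ j)) (at z)"
    by (cases "j = k")
      (auto simp: bt_num_def ring_distribs fun_eq_iff intro!: derivative_eq_intros lin)
  have den: "(bt_den k u has_derivative (\<lambda>v. bt_den k u (z + v) - bt_den k u z)) (at z)"
    unfolding bt_den_def[abs_def]
    by (auto simp: ring_distribs fun_eq_iff intro!: derivative_eq_intros lin)
  show "((\<lambda>x. ball_translation k u x $ j) has_derivative (\<lambda>v. bt_deriv k u z v $ j)) (at z)"
    using has_derivative_divide'[OF num den assms]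
    by (simp add: ball_translation_def bt_deriv_def power2_eq_square)
qed

text \<open>For \<open>u \<noteq> 0\<close> the pole of the Moebius map has modulus \<open>(1 + u\<^sup>2) / (2 \<bar>u\<bar>) > 1\<close>,
  because \<open>(1 - \<bar>u\<bar>)\<^sup>2 > 0\<close>.\<close>

lemma bt_den_nonzero:
  assumes "z \<in> std_sphere" "\<bar>u\<bar> < 1"
  shows "bt_den k u z \<noteq> 0"
proof
  assume "bt_den k u z = 0"
  then have "of_real (1 + u\<^sup>2) = - (of_real (2 * u) * z $ k)"
    by (simp add: bt_den_def add_eq_0_iff2)
  then have "cmod (of_real (1 + u\<^sup>2)) = cmod (of_real (2 * u) * z $ k)"
    by (metis norm_minus_cancel)
  then have "1 + u\<^sup>2 = 2 * \<bar>u\<bar> * cmod (z $ k)"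
    by (simp add: norm_mult abs_mult del: of_real_add of_real_mult of_real_power)
  also have "cmod (z $ k) \<le> 1"
    using assms(1) Finite_Cartesian_Product.norm_nth_le[of z k]
    by (simp add: std_sphere_eq_sphere)
  then have "2 * \<bar>u\<bar> * cmod (z $ k) \<le> 2 * \<bar>u\<bar>"
    by (simp add: mult_left_le)
  finally have "(1 - \<bar>u\<bar>)\<^sup>2 \<le> 0"
    by (simp add: power2_diff)
  then show False using assms(2) by simp
qed

text \<open>The linear map of homogeneous coordinates preserves, up to a factor, the hermitian form
  whose isotropic lines are the points of the sphere.  In the plane of the \<open>k\<close>-th and the
  homogeneous coordinate it is, for \<open>\<bar>u\<bar> < 1\<close>, \<open>1 - u\<^sup>2\<close> times a Lorentz boost, since
  \<open>(1 + u\<^sup>2)\<^sup>2 - (2 u)\<^sup>2 = (1 - u\<^sup>2)\<^sup>2\<close>, and on the remaining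
  coordinates it is multiplication by \<open>1 - u\<^sup>2\<close>.\<close>

lemma bt_hermitian:
  "(\<Sum>j\<in>UNIV. bt_num k u z $ j * cnj (bt_num k u w $ j)) - bt_den k u z * cnj (bt_den k u w)
    = of_real ((1 - u\<^sup>2)\<^sup>2) * ((\<Sum>j\<in>UNIV. z $ j * cnj (w $ j)) - 1)"
proof -
  have split: "(\<Sum>j\<in>UNIV. f j) = f k + (\<Sum>j\<in>UNIV - {k}. f j)" for f :: "'a \<Rightarrow> complex"
    by (simp add: sum.remove)
  have "(\<Sum>j\<in>UNIV - {k}. bt_num k u z $ j * cnj (bt_num k u w $ j))
      = of_real ((1 - u\<^sup>2)\<^sup>2) * (\<Sum>j\<in>UNIV - {k}. z $ j * cnj (w $ j))"
    unfolding sum_distrib_left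
    by (rule sum.cong) (auto simp: bt_num_def power2_eq_square)
  moreover have "bt_num k u z $ k * cnj (bt_num k u w $ k) - bt_den k u z * cnj (bt_den k u w)
      = of_real ((1 - u\<^sup>2)\<^sup>2) * (z $ k * cnj (w $ k) - 1)"
    by (simp add: bt_num_def bt_den_def) algebra
  ultimately show ?thesis
    unfolding split[of "\<lambda>j. bt_num k u z $ j * cnj (bt_num k u w $ j)"]
      split[of "\<lambda>j. z $ j * cnj (w $ j)"]
    by algebra
qed

lemma sphere_iff_hermitian:
  "z \<in> std_sphere \<longleftrightarrow> (\<Sum>j\<in>UNIV. z $ j * cnj (z $ j)) = 1"
proof -
  have "(\<Sum>j\<in>UNIV. z $ j * cnj (z $ j)) = of_real (\<Sum>j\<in>UNIV. (cmod (z $ j))\<^sup>2)"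
    by (simp only: of_real_sum complex_norm_square)
  then show ?thesis
    unfolding std_sphere_def mem_Collect_eq by (simp only: of_real_eq_1_iff)
qed

lemma ball_translation_in_sphere:
  assumes "z \<in> std_sphere" "\<bar>u\<bar> < 1"
  shows "ball_translation k u z \<in> std_sphere"
proof -
  have nz: "bt_den k u z \<noteq> 0" using bt_den_nonzero assms .
  have "(\<Sum>j\<in>UNIV. bt_num k u z $ j * cnj (bt_num k u z $ j)) = bt_den k u z * cnj (bt_den k u z)"
    using bt_hermitian[of k u z z] assms(1) by (simp add: sphere_iff_hermitian)
  then show ?thesis
    using nz by (simp add: sphere_iff_hermitian ball_translation_def flip: sum_divide_distrib)
qed

lemma bt_den_ball_translation:
  assumes "bt_den k u z \<noteq> 0"
  shows "bt_den k (- u) (ball_translation k u z) = of_real ((1 - u\<^sup>2)\<^sup>2) / bt_den k u z"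
  using assms by (simp add: bt_den_def[of k "- u"] ball_translation_def field_simps)
    (simp add: bt_den_def bt_num_def power2_eq_square algebra_simps)

lemma ball_translation_inverse:
  assumes "bt_den k u z \<noteq> 0" "\<bar>u\<bar> < 1"
  shows "ball_translation k (- u) (ball_translation k u z) = z"
proof -
  define K where "K = complex_of_real (1 - u\<^sup>2)"
  have "u\<^sup>2 < 1" using assms(2) by (simp add: abs_square_less_1)
  then have K: "K \<noteq> 0" 
    unfolding K_def by (metis diff_gt_0_iff_gt less_numeral_extra(3) of_real_eq_0_iff)
  have K2: "complex_of_real ((1 - u\<^sup>2)\<^sup>2) = K\<^sup>2"
    unfolding K_def by (rule of_real_power)
  have num: "bt_num k (- u) (ball_translation k u z) $ j = K\<^sup>2 * z $ j / bt_den k u z" for j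
    using assms(1) unfolding K_def
    by (simp add: bt_num_def[of k "- u"] ball_translation_def field_simps)
      (auto simp: bt_den_def bt_num_def power2_eq_square algebra_simps)
  show ?thesis
    using assms(1) K
    by (simp add: vec_eq_iff ball_translation_def[of k "-u"] num bt_den_ball_translation K2
        del: of_real_power)
qed

text \<open>The infinitesimal form of the invariance.  Comparing \<open>bt_hermitian\<close> at the pairs
  \<open>(z, z + v)\<close> and \<open>(z, z)\<close> gives the pairing of \<open>z\<close> with \<open>v\<close>.
  The quotient rule changes the image of \<open>v\<close> by a multiple of the homogeneous vector of the
  image point, and this multiple pairs to zero because that vector is isotropic.  Apart from
  the constant in \<open>bt_hermitian\<close>, what remains is division by the squared modulus of the
  denominator.\<close>

lemma hermitian_ball_translation:
  assumes z: "z \<in> std_sphere" and u: "\<bar>u\<bar> < 1"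
  shows "(\<Sum>j\<in>UNIV. ball_translation k u z $ j * cnj (bt_deriv k u z v $ j))
      = of_real ((1 - u\<^sup>2)\<^sup>2 / (cmod (bt_den k u z))\<^sup>2) * (\<Sum>j\<in>UNIV. z $ j * cnj (v $ j))"
proof -
  define D D' where "D = bt_den k u z" and "D' = bt_den k u (z + v)"
  define h where "h = (\<Sum>j\<in>UNIV. z $ j * cnj (v $ j))"
  define K where "K = complex_of_real ((1 - u\<^sup>2)\<^sup>2)"
  define S where "S w = (\<Sum>j\<in>UNIV. bt_num k u z $ j * cnj (bt_num k u w $ j))" for w
  have D: "D \<noteq> 0" using bt_den_nonzero[OF z u] by (simp add: D_def)
  have S: "S z = D * cnj D" "S (z + v) = D * cnj D' + K * h"
    using bt_hermitian[of k u z z] bt_hermitian[of k u z "z + v"] z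
    unfolding S_def D_def D'_def K_def h_def
    by (simp_all add: sphere_iff_hermitian distrib_left sum.distrib algebra_simps)
  have "(\<Sum>j\<in>UNIV. ball_translation k u z $ j * cnj (bt_deriv k u z v $ j))
      = (\<Sum>j\<in>UNIV. ((bt_num k u z $ j * cnj (bt_num k u (z + v) $ j)
              - bt_num k u z $ j * cnj (bt_num k u z $ j)) * cnj D
            - bt_num k u z $ j * cnj (bt_num k u z $ j) * cnj (D' - D)) / (D * (cnj D)\<^sup>2))"
    using D[unfolded D_def]
    by (intro sum.cong)
      (simp_all add: ball_translation_def bt_deriv_def D_def D'_def field_simps)
  also have "\<dots> = ((S (z + v) - S z) * cnj D - S z * cnj (D' - D)) / (D * (cnj D)\<^sup>2)"
    unfolding S_def sum_subtractf[symmetric] sum_distrib_right sum_divide_distrib ..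
  also have "\<dots> = K * h / (D * cnj D)"
    unfolding S using D by (simp add: field_simps power2_eq_square)
  also have "\<dots> = of_real ((1 - u\<^sup>2)\<^sup>2 / (cmod D)\<^sup>2) * h"
    by (simp add: K_def complex_mult_cnj cmod_power2)
  finally show ?thesis
    by (simp add: D_def h_def)
qed

text \<open>The contact form is a multiple of the imaginary part of the hermitian product, so it
  inherits any real scaling factor of the latter.\<close>

lemma alpha_st_eq_hermitian:
  "alpha_st z v = \<i> / 4 * ((\<Sum>j\<in>UNIV. z $ j * cnj (v $ j)) - cnj (\<Sum>j\<in>UNIV. z $ j * cnj (v $ j)))"
  by (simp only: alpha_st_def sum_subtractf cnj_sum complex_cnj_mult complex_cnj_cnj)

lemma alpha_st_ball_translation:
  assumes "z \<in> std_sphere" "\<bar>u\<bar> < 1"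
  shows "alpha_st (ball_translation k u z) (bt_deriv k u z v)
      = of_real ((1 - u\<^sup>2)\<^sup>2 / (cmod (bt_den k u z))\<^sup>2) * alpha_st z v"
  unfolding alpha_st_eq_hermitian hermitian_ball_translation[OF assms]
  by (simp only: complex_cnj_mult complex_cnj_complex_of_real) (simp add: algebra_simps)

lemma tangent_ball_translation:
  assumes u: "\<bar>u\<bar> < 1" and v: "v \<in> tangent_space std_sphere z"
  shows "bt_deriv k u z v \<in> tangent_space std_sphere (ball_translation k u z)"
proof -
  from v obtain \<gamma> e where \<gamma>: "\<gamma> 0 = z" "e > 0" "smooth_on_open {-e<..<e} \<gamma>"
    "\<gamma> ` {-e<..<e} \<subseteq> std_sphere" "(\<gamma> has_vector_derivative v) (at 0)"
    unfolding tangent_space_def smooth_curve_at_def by auto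
  have z: "z \<in> std_sphere" using \<gamma> by force
  have nz: "bt_den k u (\<gamma> t) \<noteq> 0" if "t \<in> {-e<..<e}" for t
    using \<gamma>(4) that u bt_den_nonzero by blast
  have "Ck_on_open n {-e<..<e} (\<lambda>t. ball_translation k u (\<gamma> t))" for n
    using \<gamma>(3) nz
    by (intro Ck_on_open_ball_translation Ck_on_open_const) (auto simp: smooth_on_open_def)
  moreover have "(\<lambda>t. ball_translation k u (\<gamma> t)) ` {-e<..<e} \<subseteq> std_sphere"
    using \<gamma>(4) u ball_translation_in_sphere by blast
  ultimately have "smooth_curve_at std_sphere (ball_translation k u z)
      (\<lambda>t. ball_translation k u (\<gamma> t))"
    using \<gamma>(1,2) unfolding smooth_curve_at_def smooth_on_open_def by auto
  moreover have "((\<lambda>t. ball_translation k u (\<gamma> t)) has_vector_derivative bt_deriv k u z v) (at 0)"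
    using vector_derivative_diff_chain_within[OF \<gamma>(5), of "ball_translation k u" "bt_deriv k u z"]
      ball_translation_has_derivative[OF bt_den_nonzero[OF z u], of k] \<gamma>(1)
    by (simp add: o_def has_derivative_at_withinI)
  ultimately show ?thesis
    unfolding tangent_space_def by blast
qed

lemma xi_st_ball_translation:
  assumes "z \<in> std_sphere" "\<bar>u\<bar> < 1" "v \<in> xi_st z"
  shows "bt_deriv k u z v \<in> xi_st (ball_translation k u z)"
  using assms by (auto simp: xi_st_def tangent_ball_translation alpha_st_ball_translation)

text \<open>Used to see that the differential maps each contact plane onto, and not only into, the
  contact plane at the image point.\<close>

lemma bt_deriv_inverse:
  assumes z: "z \<in> std_sphere" and u: "\<bar>u\<bar> < 1"
  shows "bt_deriv k (- u) (ball_translation k u z) (bt_deriv k u z v) = v"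
proof -
  let ?f = "ball_translation k u" and ?g = "ball_translation k (- u)"
  have nz: "bt_den k u z \<noteq> 0" "bt_den k (- u) (?f z) \<noteq> 0"
    using bt_den_nonzero[OF z u] bt_den_nonzero[OF ball_translation_in_sphere[OF z u]] u
    by simp_all
  have "open {y. bt_den k u y \<noteq> 0}"
    unfolding bt_den_def by (intro open_Collect_neq continuous_intros)
  moreover have "(?g \<circ> ?f has_derivative bt_deriv k (- u) (?f z) \<circ> bt_deriv k u z) (at z)"
    by (intro diff_chain_at ball_translation_has_derivative nz)
  ultimately have "((\<lambda>y. y) has_derivative bt_deriv k (- u) (?f z) \<circ> bt_deriv k u z) (at z)"
    using nz u ball_translation_inverse
    by (auto intro!: has_derivative_transform_within_open[of "?g \<circ> ?f"])
  then have "bt_deriv k (- u) (?f z) \<circ> bt_deriv k u z = (\<lambda>y. y)"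
    using has_derivative_unique has_derivative_ident by blast
  then show ?thesis by (simp add: fun_eq_iff)
qed

lemma preserves_field_ball_translation:
  assumes u: "\<bar>u\<bar> < 1"
  shows "preserves_field std_sphere xi_st (ball_translation k u)"
  unfolding preserves_field_def
proof
  fix z :: "complex ^ 'a"
  assume z: "z \<in> std_sphere"
  let ?f = "ball_translation k u" and ?g = "ball_translation k (- u)"
  have fz: "?f z \<in> std_sphere" and u': "\<bar>- u\<bar> < 1"
    using z u ball_translation_in_sphere by auto
  have gf: "?g (?f z) = z"
    by (rule ball_translation_inverse[OF bt_den_nonzero[OF z u] u])
  have "differential std_sphere ?f z v = bt_deriv k u z v" if "v \<in> xi_st z" for v
    by (rule differential_eq[of _ _ _ _ _ UNIV])
      (use that ball_translation_has_derivative[OF bt_den_nonzero[OF z u]] in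
        \<open>auto simp: xi_st_def\<close>)
  then have "differential std_sphere ?f z ` xi_st z = bt_deriv k u z ` xi_st z"
    by auto
  also have "\<dots> = xi_st (?f z)"
  proof (intro equalityI subsetI)
    fix w assume w: "w \<in> xi_st (?f z)"
    have "bt_deriv k (- u) (?f z) w \<in> xi_st z"
      using xi_st_ball_translation[OF fz u' w, of k] gf by simp
    moreover have "bt_deriv k u z (bt_deriv k (- u) (?f z) w) = w"
      using bt_deriv_inverse[OF fz u', of k w] gf by simp
    ultimately show "w \<in> bt_deriv k u z ` xi_st z" by force
  qed (use xi_st_ball_translation[OF z u] in auto)
  finally show "differential std_sphere ?f z ` xi_st z = xi_st (?f z)" .
qed

lemma smooth_map_on_ball_translation:
  assumes "\<bar>u\<bar> < 1"
  shows "smooth_map_on std_sphere (ball_translation k u)"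
proof -
  let ?U = "{z. bt_den k u z \<noteq> 0}"
  have "open ?U"
    unfolding bt_den_def by (intro open_Collect_neq continuous_intros)
  then have "smooth_on_open ?U (ball_translation k u)"
    unfolding smooth_on_open_def
    by (auto intro!: Ck_on_open_ball_translation Ck_on_open_const Ck_on_open_ident)
  moreover have "std_sphere \<subseteq> ?U"
    using assms bt_den_nonzero by blast
  ultimately show ?thesis
    unfolding smooth_map_on_def by blast
qed

lemma diffeomorphism_of_ball_translation:
  assumes u: "\<bar>u\<bar> < 1"
  shows "diffeomorphism_of std_sphere (ball_translation k u)"
proof -
  let ?S = "std_sphere :: (complex ^ 'a) set"
  let ?f = "ball_translation k u" and ?g = "ball_translation k (- u)"
  have u': "\<bar>- u\<bar> < 1" using u by simp
  have gf: "?g (?f z) = z" and fg: "?f (?g z) = z" if "z \<in> ?S" for z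
    using ball_translation_inverse[OF bt_den_nonzero[OF that u] u, of k]
      ball_translation_inverse[OF bt_den_nonzero[OF that u'] u', of k] by auto
  have bij: "bij_betw ?f ?S ?S"
    by (rule bij_betw_byWitness[where f' = ?g])
      (use gf fg u u' ball_translation_in_sphere in blast)+
  have "inv_into ?S ?f z = ?g z" if "z \<in> ?S" for z
    using inv_into_f_eq[OF bij_betw_imp_inj_on[OF bij] ball_translation_in_sphere fg] that u'
    by blast
  then have "smooth_map_on ?S (inv_into ?S ?f)"
    using smooth_map_on_ball_translation[OF u', of k] by (simp add: smooth_map_on_def)
  then show ?thesis
    unfolding diffeomorphism_of_def
    using bij smooth_map_on_ball_translation[OF u] by blast
qed

lemma contact_isotopy_ball_translation:
  assumes \<rho>: "0 \<le> \<rho>" "\<rho> < 1"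
  shows "contact_isotopy std_sphere xi_st (\<lambda>t. ball_translation k (\<rho> * t))"
  unfolding contact_isotopy_def
proof
  let ?U = "{p :: real \<times> (complex ^ 'a). bt_den k (\<rho> * fst p) (snd p) \<noteq> 0}"
  let ?F = "\<lambda>p :: real \<times> (complex ^ 'a). ball_translation k (\<rho> * fst p) (snd p)"
  have u: "\<bar>\<rho> * t\<bar> < 1" if "t \<in> {0..1}" for t
    using \<rho> that mult_left_le[of t \<rho>] by (simp add: abs_mult)
  have U: "open ?U"
    unfolding bt_den_def by (intro open_Collect_neq continuous_intros)
  have "smooth_on_open ?U ?F"
    unfolding smooth_on_open_def
    using U
    by (auto intro!: Ck_on_open_ball_translation
        Ck_on_open_bounded_linear[OF bounded_linear_fst]
        Ck_on_open_bounded_linear[OF bounded_linear_snd]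
        Ck_on_open_mult Ck_on_open_const Ck_on_open_ident)
  moreover have "{0..1} \<times> std_sphere \<subseteq> ?U"
    using u bt_den_nonzero by fastforce
  moreover have "?F p = (\<lambda>(t, x). ball_translation k (\<rho> * t) x) p" for p
    by (simp add: case_prod_beta)
  ultimately show "smooth_map_on ({0..1} \<times> std_sphere)
      (\<lambda>(t, x :: complex ^ 'a). ball_translation k (\<rho> * t) x)"
    unfolding smooth_map_on_def by blast
  show "\<forall>t\<in>{0..1}. diffeomorphism_of (std_sphere :: (complex ^ 'a) set) (ball_translation k (\<rho> * t)) \<and>
      preserves_field std_sphere xi_st (ball_translation k (\<rho> * t))"
    using u diffeomorphism_of_ball_translation preserves_field_ball_translation by blast
qed

section \<open>Displacing the fiber\<close>

lemma ball_translation_0: "ball_translation k 0 z = z"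
  by (simp add: vec_eq_iff ball_translation_def bt_num_def bt_den_def)

text \<open>Among the points \<open>\<zeta>\<close> of the circle of radius \<open>c\<close>, the one whose image
  has the smallest modulus is \<open>-c\<close>; its image is outside the circle because
  \<open>\<rho> (1 + c\<^sup>2) - c (1 + \<rho>\<^sup>2) = (\<rho> - c) (1 - \<rho> c) > 0\<close>.
  The proof compares squared moduli, whose difference is affine in \<open>Re \<zeta>\<close>.\<close>

lemma ball_translation_pushes_off:
  assumes c: "0 < c" "c < \<rho>" "\<rho> < 1" and z: "cmod (z $ k) = c" "bt_den k \<rho> z \<noteq> 0"
  shows "c < cmod (ball_translation k \<rho> z $ k)"
proof -
  let ?x = "Re (z $ k)"
  have N: "(cmod (bt_num k \<rho> z $ k))\<^sup>2
      = (1 + \<rho>\<^sup>2)\<^sup>2 * c\<^sup>2 + 4 * \<rho>\<^sup>2 + 4 * \<rho> * (1 + \<rho>\<^sup>2) * ?x"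
    and D: "(cmod (bt_den k \<rho> z))\<^sup>2
      = (1 + \<rho>\<^sup>2)\<^sup>2 + 4 * \<rho>\<^sup>2 * c\<^sup>2 + 4 * \<rho> * (1 + \<rho>\<^sup>2) * ?x"
    unfolding z(1)[symmetric] cmod_power2 bt_num_def bt_den_def
    by (simp_all add: power2_eq_square algebra_simps)
  have "(cmod (bt_num k \<rho> z $ k))\<^sup>2 - c\<^sup>2 * (cmod (bt_den k \<rho> z))\<^sup>2
      = 4 * \<rho> * (1 - c\<^sup>2) * (\<rho> * (1 + c\<^sup>2) + (1 + \<rho>\<^sup>2) * ?x)"
    unfolding N D by algebra
  moreover have "\<rho> * (1 + c\<^sup>2) + (1 + \<rho>\<^sup>2) * ?x > 0"
  proof -
    have "0 < (\<rho> - c) * (1 - \<rho> * c)"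
      using c mult_strict_mono[of \<rho> 1 c 1] by simp
    also have "\<dots> = \<rho> * (1 + c\<^sup>2) + (1 + \<rho>\<^sup>2) * (- c)"
      by algebra
    also have "- c \<le> ?x"
      using abs_Re_le_cmod[of "z $ k"] z(1) by linarith
    then have "\<rho> * (1 + c\<^sup>2) + (1 + \<rho>\<^sup>2) * (- c) \<le> \<rho> * (1 + c\<^sup>2) + (1 + \<rho>\<^sup>2) * ?x"
      by (intro add_left_mono mult_left_mono) auto
    finally show ?thesis .
  qed
  moreover have "c\<^sup>2 < 1"
    using c by (simp add: abs_square_less_1)
  ultimately have "0 < (cmod (bt_num k \<rho> z $ k))\<^sup>2 - c\<^sup>2 * (cmod (bt_den k \<rho> z))\<^sup>2"
    using c by simp
  then have "(c * cmod (bt_den k \<rho> z))\<^sup>2 < (cmod (bt_num k \<rho> z $ k))\<^sup>2"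
    by (simp add: power_mult_distrib)
  then have "c * cmod (bt_den k \<rho> z) < cmod (bt_num k \<rho> z $ k)"
    by (rule power2_less_imp_less) simp
  then show ?thesis
    using z(2) by (simp add: ball_translation_def norm_divide less_divide_eq)
qed

theorem proposition1p1:
  fixes c :: "real ^ 'd"
  assumes "CARD('d) \<ge> 2"
    and "\<And>j. 0 < c $ j \<and> c $ j < 1"
    and "(\<Sum>j\<in>UNIV. (c $ j)\<^sup>2) = 1"
  shows "displaceable std_sphere xi_st (toric_fiber c)"
proof -
  fix k :: 'd
  obtain \<rho> where \<rho>: "c $ k < \<rho>" "\<rho> < 1"
    using assms(2) dense by blast
  have "0 < c $ k" using assms(2) by blast
  have "ball_translation k \<rho> z \<notin> toric_fiber c" if "z \<in> toric_fiber c" for z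
  proof -
    have "bt_den k \<rho> z \<noteq> 0"
      using that \<rho> \<open>0 < c $ k\<close> by (intro bt_den_nonzero) (auto simp: toric_fiber_def)
    then have "c $ k < cmod (ball_translation k \<rho> z $ k)"
      using that \<rho> \<open>0 < c $ k\<close> by (intro ball_translation_pushes_off) (auto simp: toric_fiber_def)
    then show ?thesis
      unfolding toric_fiber_def by (metis (mono_tags, lifting) less_irrefl mem_Collect_eq)
  qed
  then have "ball_translation k (\<rho> * 1) ` toric_fiber c \<inter> toric_fiber c = {}"
    by auto
  moreover have "contact_isotopy std_sphere xi_st (\<lambda>t. ball_translation k (\<rho> * t))"
    using \<rho> \<open>0 < c $ k\<close> by (intro contact_isotopy_ball_translation) auto
  moreover have "ball_translation k (\<rho> * 0) z = z" for z
    by (simp add: ball_translation_0)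
  ultimately show ?thesis
    unfolding displaceable_def by blast
qed

end
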